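(* For each $n\ge 2$ and each $k\ge 1$ there exists a $1$-PDDS$[P_k]$ in $\Lambda_n$.
   Context: $\Lambda_n$ is the infinite graph with vertex set $\mathbb{Z}^n$ in which two vertices are adjacent iff their Euclidean distance is $1$; $d$ denotes graph distance. For $S$ a set of vertices, $[S]$ is the induced subgraph and $d(v,C)=\min\{d(v,w):w\in C\}$. For $t\ge1$, $S$ is a $t$-perfect distance-dominating set ($t$-PDDS) if for each vertex $v$ there is a unique component $C_v$ of $[S]$ with $d(v,C_v)\le t$, and there is in $C_v$ a unique vertex $w$ with $d(v,w)=d(v,C_v)$. A $t$-PDDS$[H]$ is a $t$-PDDS all of whose components are isomorphic to the fixed finite graph $H$. $P_k$ is the path on $k$ vertices. *)

theory Defs
  imports "Graph_Theory.Graph_Theory" "HOL-Analysis.L2_Norm" "HOL-Library.FuncSet"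
begin

text \<open>
  Undirected graphs are symmetric digraphs whose arcs are ordered pairs: an edge between \<open>x\<close> and
  \<open>y\<close> is the pair of arcs \<open>(x, y)\<close> and \<open>(y, x)\<close>.
\<close>

text \<open>
  A point of \<open>\<int>\<^sup>n\<close> is an integer function on \<open>{..<n}\<close>, made \<open>undefined\<close> outside \<open>{..<n}\<close> by
  \<open>\<rightarrow>\<^sub>E\<close>.
\<close>

definition lattice_points :: "nat \<Rightarrow> (nat \<Rightarrow> int) set" where
  "lattice_points n = {..<n} \<rightarrow>\<^sub>E (UNIV :: int set)"

definition euclid_dist :: "nat \<Rightarrow> (nat \<Rightarrow> int) \<Rightarrow> (nat \<Rightarrow> int) \<Rightarrow> real" where
  "euclid_dist n x y = L2_set (\<lambda>i. real_of_int (x i) - real_of_int (y i)) {..<n}"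

definition lattice_graph ::
    "nat \<Rightarrow> (nat \<Rightarrow> int, (nat \<Rightarrow> int) \<times> (nat \<Rightarrow> int)) pre_digraph" where
  "lattice_graph n = with_proj
     \<lparr> pverts = lattice_points n,
       parcs = {(x, y). x \<in> lattice_points n \<and> y \<in> lattice_points n \<and> euclid_dist n x y = 1} \<rparr>"

definition path_graph :: "nat \<Rightarrow> (nat, nat \<times> nat) pre_digraph" where
  "path_graph k = with_proj
     \<lparr> pverts = {..<k}, parcs = {(i, j). i < k \<and> j < k \<and> (j = Suc i \<or> i = Suc j)} \<rparr>"

lemma sym_digraph_lattice_graph: "sym_digraph (lattice_graph n)"
  by unfold_locales
    (auto simp: lattice_graph_def with_proj_def symmetric_def arcs_ends_def arc_to_ends_def
      euclid_dist_def L2_set_def power2_commute intro!: symI)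

lemma graph_path_graph: "graph (path_graph k)"
proof unfold_locales
  have "{(i, j). i < k \<and> j < k \<and> (j = Suc i \<or> i = Suc j)} \<subseteq> {..<k} \<times> {..<k}"
    by auto
  then show "finite (arcs (path_graph k))"
    by (simp add: path_graph_def with_proj_def finite_subset)
qed (auto simp: path_graph_def with_proj_def symmetric_def arcs_ends_def arc_to_ends_def
    intro!: symI)

definition components :: "('a, 'b) pre_digraph \<Rightarrow> ('a, 'b) pre_digraph set" where
  "components G = {C. pre_digraph.max_subgraph G Digraph_Component.connected C}"

text \<open>
  The distance is \<open>\<infinity>\<close> between vertices not joined by a walk. Finite distances are natural numbers,
  so the infimum over a component is a minimum.
\<close>

definition graph_dist :: "('a, 'b) pre_digraph \<Rightarrow> 'a \<Rightarrow> 'a \<Rightarrow> ereal" where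
  "graph_dist G v w = wf_digraph.\<mu> G (\<lambda>_. 1) v w"

definition set_dist :: "('a, 'b) pre_digraph \<Rightarrow> 'a \<Rightarrow> 'a set \<Rightarrow> ereal" where
  "set_dist G v W = (INF w\<in>W. graph_dist G v w)"

definition PDDS :: "('a, 'b) pre_digraph \<Rightarrow> nat \<Rightarrow> 'a set \<Rightarrow> bool" where
  "PDDS G t S \<longleftrightarrow> S \<subseteq> verts G \<and>
     (\<forall>v\<in>verts G. \<exists>C.
        (\<forall>D. D \<in> components (G \<restriction> S) \<and> set_dist G v (verts D) \<le> ereal (real t) \<longleftrightarrow> D = C) \<and>
        (\<exists>!w. w \<in> verts C \<and> graph_dist G v w = set_dist G v (verts C)))"

definition PDDS_of ::
    "('a, 'b) pre_digraph \<Rightarrow> nat \<Rightarrow> ('c, 'd) pre_digraph \<Rightarrow> 'a set \<Rightarrow> bool" where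
  "PDDS_of G t H S \<longleftrightarrow> PDDS G t S \<and> (\<forall>C\<in>components (G \<restriction> S). digraph_iso C H)"

end

theory Submission
  imports Defs
begin

text \<open>
  Put \<open>m = (2n - 1)k + 2\<close>, the size of the closed neighbourhood of a straight path with \<open>k\<close>
  vertices, and colour \<open>x \<in> \<int>\<^sup>n\<close> by \<open>(\<Sum>i<n. (i k + 1) x\<^sub>i) mod m\<close>. Let \<open>S\<close> consist of the
  points of colour less than \<open>k\<close>. A step along axis \<open>i\<close> changes the colour by \<open>\<plusminus>(i k + 1)\<close>, and
  the intervals \<open>[0, k) \<plusminus> (i k + 1)\<close> with \<open>0 < i < n\<close>, together with \<open>[-1, k]\<close>, partition the
  residues modulo \<open>m\<close>. Hence two points of \<open>S\<close> are adjacent only along axis \<open>0\<close>, so that the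
  components of \<open>S\<close> are straight paths, and every point outside \<open>S\<close> has exactly one neighbour
  in \<open>S\<close>.
\<close>

section \<open>Components, distances and isomorphisms\<close>

lemma adj_induce_subgraph_iff:
  "u \<rightarrow>\<^bsub>G \<restriction> S\<^esub> v \<longleftrightarrow> u \<in> S \<and> v \<in> S \<and> u \<rightarrow>\<^bsub>G\<^esub> v"
  by (auto simp: arcs_ends_conv)

lemma induce_subgraph_induce_subgraph:
  "T \<subseteq> S \<Longrightarrow> (G \<restriction> S) \<restriction> T = G \<restriction> T"
  by (auto simp: induce_subgraph_def)

lemma strongly_connected_imp_connected:
  assumes "strongly_connected G"
  shows "Digraph_Component.connected G"
proof -
  have "(u, v) \<in> rtrancl_on (verts G) ((arcs_ends G)\<^sup>s)" if "u \<in> verts G" "v \<in> verts G" for u v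
  proof (rule rtrancl_on_mono)
    show "arcs_ends G \<subseteq> (arcs_ends G)\<^sup>s"
      by (auto simp: symcl_def)
    show "(u, v) \<in> rtrancl_on (verts G) (arcs_ends G)"
      using assms that by (simp add: strongly_connected_def reachable_def)
  qed simp
  then show ?thesis
    using assms by (simp add: connected_conv strongly_connected_def)
qed

lemma arc_mono_connected: "arc_mono Digraph_Component.connected"
  unfolding arc_mono_def
  by (metis spanning_def subgraphE wf_digraph.connected_spanning_imp_connected)

lemma (in pre_digraph) max_subgraph_if_agree_on_induced:
  assumes max_H: "max_subgraph P H" and mono: "arc_mono P" "arc_mono Q"
    and agree: "\<And>K. induced_subgraph K G \<Longrightarrow> P K \<longleftrightarrow> Q K"
  shows "max_subgraph Q H"
proof (rule max_subgraphI)
  show "Q H"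
    using agree[OF induced_subgraphI_arc_mono[OF max_H mono(1)]] max_subgraph_prop[OF max_H] by simp
  show "subgraph H G" using max_H by (rule subgraphI_max_subgraph)
  fix K assume K: "H \<noteq> K" "subgraph H K" "subgraph K G"
  interpret wf_digraph G using K(3) by blast
  let ?K = "G \<restriction> verts K"
  have sub: "subgraph K ?K" "induced_subgraph ?K G"
    using K(3) by (auto intro: subgraph_induce_subgraphI2)
  show "\<not> Q K"
  proof
    assume "Q K"
    then have "Q ?K"
      using mono(2) sub(1) unfolding arc_mono_def by (metis induce_subgraph_verts)
    then have "P ?K"
      using agree sub(2) by simp
    then have "H = ?K"
      using max_H K(2) sub unfolding max_subgraph_def
      by (metis induced_imp_subgraph subgraph_trans)
    then show False
      using K(1,2) sub(1)
      by (auto simp: subgraph_def compatible_def induce_subgraph_def intro!: pre_digraph.equality)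
  qed
qed

lemma (in sym_digraph) components_eq_sccs: "components G = sccs"
proof -
  have agree: "Digraph_Component.connected K \<longleftrightarrow> strongly_connected K"
    if induced_K: "induced_subgraph K G" for K
  proof -
    interpret K: sym_digraph K
      using induced_K by (rule induced_graph_imp_graph)
    show ?thesis
      using K.symmetric_connected_imp_strongly_connected[OF K.sym_arcs]
        strongly_connected_imp_connected by blast
  qed
  have "max_subgraph Digraph_Component.connected H \<longleftrightarrow> max_subgraph strongly_connected H" for H
    using max_subgraph_if_agree_on_induced agree arc_mono_connected arc_mono_strongly_connected
    by metis
  then show ?thesis
    by (simp add: components_def sccs_altdef2)
qed

lemma (in sym_digraph) components_eq_induce_scc_of: "components G = (\<lambda>v. G \<restriction> scc_of v) ` verts G"
  by (simp add: components_eq_sccs sccs_conv_sccs_verts sccs_verts_conv_scc_of image_image)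

lemma (in wf_digraph) awalk_cost_const_1: "awalk_cost (\<lambda>_. 1) p = real (length p)"
  by (induction p) simp_all

lemma (in wf_digraph) graph_dist_eq_INF_length:
  "graph_dist G v w = (INF p\<in>{p. awalk v p w}. ereal (real (length p)))"
  by (simp add: graph_dist_def \<mu>_def awalk_cost_const_1)

lemma (in wf_digraph) graph_dist_le_iff:
  "graph_dist G v w \<le> ereal (real t) \<longleftrightarrow> (\<exists>p. awalk v p w \<and> length p \<le> t)"
proof
  assume dist_le: "graph_dist G v w \<le> ereal (real t)"
  show "\<exists>p. awalk v p w \<and> length p \<le> t"
  proof (rule ccontr)
    assume "\<not> ?thesis"
    then have "ereal (real (Suc t)) \<le> graph_dist G v w"
      unfolding graph_dist_eq_INF_length by (intro INF_greatest) (auto simp: not_le)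
    also note dist_le
    finally show False by simp
  qed
next
  assume "\<exists>p. awalk v p w \<and> length p \<le> t"
  then show "graph_dist G v w \<le> ereal (real t)"
    unfolding graph_dist_eq_INF_length by (auto intro!: INF_lower2)
qed

lemma (in wf_digraph) set_dist_le_iff:
  "set_dist G v W \<le> ereal (real t) \<longleftrightarrow> (\<exists>w\<in>W. graph_dist G v w \<le> ereal (real t))"
proof
  assume dist_le: "set_dist G v W \<le> ereal (real t)"
  show "\<exists>w\<in>W. graph_dist G v w \<le> ereal (real t)"
  proof (rule ccontr)
    assume "\<not> ?thesis"
    then have "\<forall>w\<in>W. \<forall>p. awalk v p w \<longrightarrow> Suc t \<le> length p"
      by (auto simp: graph_dist_le_iff not_le Suc_le_eq)
    then have "ereal (real (Suc t)) \<le> set_dist G v W"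
      unfolding set_dist_def graph_dist_eq_INF_length
      by (intro INF_greatest) (auto simp del: of_nat_Suc)
    also note dist_le
    finally show False by simp
  qed
next
  assume "\<exists>w\<in>W. graph_dist G v w \<le> ereal (real t)"
  then show "set_dist G v W \<le> ereal (real t)"
    unfolding set_dist_def by (blast intro: INF_lower2)
qed

lemma (in wf_digraph) graph_dist_nonneg: "0 \<le> graph_dist G v w"
  unfolding graph_dist_eq_INF_length by (intro INF_greatest) simp

lemma (in wf_digraph) graph_dist_eq_0_iff: "graph_dist G v w = 0 \<longleftrightarrow> v \<in> verts G \<and> v = w"
  using graph_dist_le_iff[of v w 0] graph_dist_nonneg[of v w]
  by (auto simp: awalk_Nil_iff antisym zero_ereal_def[symmetric])

lemma (in wf_digraph) graph_dist_le_1_iff: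
  "graph_dist G v w \<le> 1 \<longleftrightarrow> v \<in> verts G \<and> v = w \<or> v \<rightarrow>\<^bsub>G\<^esub> w"
proof -
  have "(\<exists>p. awalk v p w \<and> length p \<le> 1) \<longleftrightarrow> awalk v [] w \<or> (\<exists>a. awalk v [a] w)"
    by (auto simp: le_Suc_eq length_Suc_conv)
  also have "\<dots> \<longleftrightarrow> v \<in> verts G \<and> v = w \<or> v \<rightarrow>\<^bsub>G\<^esub> w"
    by (auto simp: awalk_Cons_iff awalk_Nil_iff arcs_ends_conv)
  finally show ?thesis
    using graph_dist_le_iff[of v w 1] by (simp add: one_ereal_def)
qed

lemma set_dist_eqI:
  assumes "w \<in> W" and "\<And>u. u \<in> W \<Longrightarrow> graph_dist G v w \<le> graph_dist G v u"
  shows "set_dist G v W = graph_dist G v w"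
  unfolding set_dist_def using assms by (intro antisym INF_lower INF_greatest)

lemma (in sym_digraph) PDDS_if_ex_nearest:
  assumes S: "S \<subseteq> verts G"
    and ex_nearest: "\<And>v. v \<in> verts G \<Longrightarrow> \<exists>w\<in>S. graph_dist G v w \<le> ereal (real t) \<and>
      (\<forall>u\<in>S. u \<noteq> w \<longrightarrow> graph_dist G v w < graph_dist G v u) \<and>
      (\<forall>u\<in>S. graph_dist G v u \<le> ereal (real t) \<longrightarrow> w \<rightarrow>\<^sup>*\<^bsub>G \<restriction> S\<^esub> u)"
  shows "PDDS G t S"
  unfolding PDDS_def
proof (intro conjI ballI)
  interpret GS: sym_digraph "G \<restriction> S"
    using S by (intro induced_graph_imp_graph induced_induce)
  have scc_of_subset: "GS.scc_of z \<subseteq> S" for z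
    by (auto simp: GS.scc_of_def dest: GS.reachable_in_verts)
  fix v assume "v \<in> verts G"
  then obtain w where w: "w \<in> S" "graph_dist G v w \<le> ereal (real t)"
    and nearest: "\<And>u. u \<in> S \<Longrightarrow> u \<noteq> w \<Longrightarrow> graph_dist G v w < graph_dist G v u"
    and reach: "\<And>u. u \<in> S \<Longrightarrow> graph_dist G v u \<le> ereal (real t) \<Longrightarrow> w \<rightarrow>\<^sup>*\<^bsub>G \<restriction> S\<^esub> u"
    using ex_nearest by metis
  let ?C = "(G \<restriction> S) \<restriction> GS.scc_of w"
  have w_scc: "w \<in> GS.scc_of w"
    using w(1) by (simp add: GS.in_scc_of_self)
  have dist_C: "set_dist G v (GS.scc_of w) = graph_dist G v w"
    using w_scc scc_of_subset nearest by (intro set_dist_eqI) (auto intro: less_imp_le)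
  have "D \<in> components (G \<restriction> S) \<and> set_dist G v (verts D) \<le> ereal (real t) \<longleftrightarrow> D = ?C" for D
  proof
    assume D: "D \<in> components (G \<restriction> S) \<and> set_dist G v (verts D) \<le> ereal (real t)"
    then obtain z where z: "D = (G \<restriction> S) \<restriction> GS.scc_of z"
      by (auto simp: GS.components_eq_induce_scc_of)
    then obtain u where u: "u \<in> GS.scc_of z" "graph_dist G v u \<le> ereal (real t)"
      using D by (auto simp: set_dist_le_iff)
    then have "u \<in> GS.scc_of w"
      using scc_of_subset by (blast intro: reach GS.scc_ofI_reachable')
    with u(1) show "D = ?C"
      by (metis GS.scc_of_eq z)
  qed (use w dist_C in \<open>simp add: GS.components_eq_induce_scc_of\<close>)
  moreover have "\<exists>!u. u \<in> verts ?C \<and> graph_dist G v u = set_dist G v (verts ?C)"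
    using w_scc scc_of_subset nearest by (intro ex1I[of _ w]) (force simp: dist_C)+
  ultimately show "\<exists>C. (\<forall>D. D \<in> components (G \<restriction> S) \<and>
        set_dist G v (verts D) \<le> ereal (real t) \<longleftrightarrow> D = C) \<and>
      (\<exists>!u. u \<in> verts C \<and> graph_dist G v u = set_dist G v (verts C))"
    by blast
qed (fact S)

lemma (in sym_digraph) PDDS_1_if_ex1_adj:
  assumes S: "S \<subseteq> verts G"
    and ex1: "\<And>v. v \<in> verts G \<Longrightarrow> v \<notin> S \<Longrightarrow> \<exists>!w. w \<in> S \<and> v \<rightarrow>\<^bsub>G\<^esub> w"
  shows "PDDS G 1 S"
proof (rule PDDS_if_ex_nearest[OF S, of 1, unfolded of_nat_1 one_ereal_def[symmetric]])
  interpret GS: wf_digraph "G \<restriction> S" ..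
  fix v assume v: "v \<in> verts G"
  show "\<exists>w\<in>S. graph_dist G v w \<le> 1 \<and> (\<forall>u\<in>S. u \<noteq> w \<longrightarrow> graph_dist G v w < graph_dist G v u) \<and>
    (\<forall>u\<in>S. graph_dist G v u \<le> 1 \<longrightarrow> w \<rightarrow>\<^sup>*\<^bsub>G \<restriction> S\<^esub> u)"
  proof (cases "v \<in> S")
    case True
    have "graph_dist G v v = 0"
      using v by (simp add: graph_dist_eq_0_iff)
    moreover have "0 < graph_dist G v u" if "u \<noteq> v" for u
      using that graph_dist_eq_0_iff[of v u] graph_dist_nonneg[of v u] by (simp add: less_le)
    moreover have "v \<rightarrow>\<^sup>*\<^bsub>G \<restriction> S\<^esub> u" if "u \<in> S" "graph_dist G v u \<le> 1" for u
    proof (cases "u = v")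
      case False
      then have "v \<rightarrow>\<^bsub>G \<restriction> S\<^esub> u"
        using that True by (auto simp: graph_dist_le_1_iff adj_induce_subgraph_iff)
      then show ?thesis ..
    qed (simp add: True)
    ultimately show ?thesis
      using True by (intro bexI[of _ v]) auto
  next
    case False
    then obtain w where w: "w \<in> S" "v \<rightarrow>\<^bsub>G\<^esub> w"
      and uniq: "\<And>u. u \<in> S \<Longrightarrow> v \<rightarrow>\<^bsub>G\<^esub> u \<Longrightarrow> u = w"
      using ex1[OF v False] by blast
    have near_iff: "graph_dist G v u \<le> 1 \<longleftrightarrow> u = w" if "u \<in> S" for u
      using that False w uniq[OF that] by (auto simp: graph_dist_le_1_iff)
    moreover have "graph_dist G v w < graph_dist G v u" if "u \<in> S" "u \<noteq> w" for u
      using near_iff[OF w(1)] near_iff[OF that(1)] that(2) by simp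
    ultimately show ?thesis
      using w(1) by (intro bexI[of _ w]) simp_all
  qed
qed

lemma digraph_iso_induce_image:
  fixes G :: "('a, 'a \<times> 'a) pre_digraph" and H :: "('b, 'b \<times> 'b) pre_digraph"
  assumes wf_H: "wf_digraph H" and inj: "inj_on p (verts H)"
    and ends: "tail G = fst" "head G = snd" "tail H = fst" "head H = snd"
    and adj_iff: "\<And>u v. u \<in> verts H \<Longrightarrow> v \<in> verts H \<Longrightarrow> p u \<rightarrow>\<^bsub>G\<^esub> p v \<longleftrightarrow> u \<rightarrow>\<^bsub>H\<^esub> v"
  shows "digraph_iso H (G \<restriction> p ` verts H)"
proof -
  define h where "h = \<lparr>iso_verts = p, iso_arcs = map_prod p p, iso_head = snd, iso_tail = fst\<rparr>"
  have arcs_H: "arcs H \<subseteq> verts H \<times> verts H"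
    using wf_digraph.tail_in_verts[OF wf_H] wf_digraph.head_in_verts[OF wf_H] ends by auto
  have "inj_on (map_prod p p) (arcs H)"
    using map_prod_inj_on[OF inj inj] arcs_H by (rule inj_on_subset)
  then have "pre_digraph.digraph_isomorphism H h"
    using inj wf_H ends by (simp add: pre_digraph.digraph_isomorphism_def h_def)
  moreover have "(p u, p v) \<in> arcs G \<longleftrightarrow> (u, v) \<in> arcs H" if "u \<in> verts H" "v \<in> verts H" for u v
    using adj_iff[OF that] ends by (simp add: arcs_ends_conv)
  then have "{e \<in> arcs G. fst e \<in> p ` verts H \<and> snd e \<in> p ` verts H} = map_prod p p ` arcs H"
    using arcs_H by force
  then have "G \<restriction> p ` verts H = app_iso h H"
    using ends by (simp add: h_def induce_subgraph_def app_iso_def)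
  ultimately show ?thesis
    unfolding digraph_iso_def by blast
qed

section \<open>Straight paths in the lattice\<close>

lemma sum_power2_eq_1_iff:
  fixes f :: "'a \<Rightarrow> int"
  assumes "finite A"
  shows "(\<Sum>i\<in>A. (f i)\<^sup>2) = 1 \<longleftrightarrow> (\<exists>i\<in>A. f i \<in> {1, -1} \<and> (\<forall>j\<in>A. j \<noteq> i \<longrightarrow> f j = 0))"
proof -
  have "(\<Sum>i\<in>A. (f i)\<^sup>2) = int (\<Sum>i\<in>A. nat ((f i)\<^sup>2))"
    by simp
  then have "(\<Sum>i\<in>A. (f i)\<^sup>2) = 1 \<longleftrightarrow> (\<Sum>i\<in>A. nat ((f i)\<^sup>2)) = 1"
    by linarith
  also have "\<dots> \<longleftrightarrow> (\<exists>i\<in>A. nat ((f i)\<^sup>2) = 1 \<and> (\<forall>j\<in>A. i \<noteq> j \<longrightarrow> nat ((f j)\<^sup>2) = 0))"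
    using assms by (rule sum_eq_1_iff)
  also have "\<dots> \<longleftrightarrow> (\<exists>i\<in>A. f i \<in> {1, -1} \<and> (\<forall>j\<in>A. j \<noteq> i \<longrightarrow> f j = 0))"
    by (auto simp: nat_eq_iff power2_eq_1_iff)
  finally show ?thesis .
qed

lemma euclid_dist_eq_1_iff:
  "euclid_dist n x y = 1 \<longleftrightarrow> (\<exists>i<n. y i - x i \<in> {1, -1} \<and> (\<forall>j<n. j \<noteq> i \<longrightarrow> y j = x j))"
proof -
  have "euclid_dist n x y = 1 \<longleftrightarrow> real_of_int (\<Sum>i<n. (x i - y i)\<^sup>2) = 1"
    by (simp add: euclid_dist_def L2_set_def)
  also have "\<dots> \<longleftrightarrow> (\<Sum>i<n. (y i - x i)\<^sup>2) = 1"
    unfolding of_int_eq_1_iff by (simp add: power2_commute)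
  also have "\<dots> \<longleftrightarrow> (\<exists>i<n. y i - x i \<in> {1, -1} \<and> (\<forall>j<n. j \<noteq> i \<longrightarrow> y j = x j))"
    by (subst sum_power2_eq_1_iff) auto
  finally show ?thesis .
qed

lemma fun_upd_in_lattice_points:
  "x \<in> lattice_points n \<Longrightarrow> i < n \<Longrightarrow> x(i := a) \<in> lattice_points n"
  by (auto simp: lattice_points_def PiE_def extensional_def)

lemma lattice_graph_adj_iff:
  assumes x: "x \<in> lattice_points n"
  shows "x \<rightarrow>\<^bsub>lattice_graph n\<^esub> y \<longleftrightarrow> (\<exists>i<n. \<exists>s\<in>{1, -1}. y = x(i := x i + s))"
proof -
  have "x \<rightarrow>\<^bsub>lattice_graph n\<^esub> y \<longleftrightarrow> y \<in> lattice_points n \<and> euclid_dist n x y = 1"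
    using x by (simp add: lattice_graph_def)
  also have "\<dots> \<longleftrightarrow> (\<exists>i<n. \<exists>s\<in>{1, -1}. y = x(i := x i + s))"
  proof
    assume y: "y \<in> lattice_points n \<and> euclid_dist n x y = 1"
    then obtain i where i: "i < n" "y i - x i \<in> {1, -1}"
      and eq: "\<And>j. j < n \<Longrightarrow> j \<noteq> i \<Longrightarrow> y j = x j"
      by (auto simp: euclid_dist_eq_1_iff)
    have "y j = x j" if "j \<noteq> i" for j
      using x y eq[of j] that
      by (cases "j < n") (simp_all add: lattice_points_def PiE_def extensional_def)
    then have "y = x(i := x i + (y i - x i))"
      by (simp add: fun_eq_iff)
    with i show "\<exists>i<n. \<exists>s\<in>{1, -1}. y = x(i := x i + s)"
      by blast
  next
    assume "\<exists>i<n. \<exists>s\<in>{1, -1}. y = x(i := x i + s)"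
    then show "y \<in> lattice_points n \<and> euclid_dist n x y = 1"
      using x by (auto simp: euclid_dist_eq_1_iff fun_upd_in_lattice_points)
  qed
  finally show ?thesis .
qed

definition axis_path :: "(nat \<Rightarrow> int) \<Rightarrow> nat \<Rightarrow> nat \<Rightarrow> int" where
  "axis_path b j = b(0 := b 0 + int j)"

lemma axis_path_in_lattice_points:
  "b \<in> lattice_points n \<Longrightarrow> 0 < n \<Longrightarrow> axis_path b j \<in> lattice_points n"
  unfolding axis_path_def by (rule fun_upd_in_lattice_points)

lemma axis_path_adj_iff:
  assumes "b \<in> lattice_points n" and n: "0 < n"
  shows "axis_path b i \<rightarrow>\<^bsub>lattice_graph n\<^esub> axis_path b j \<longleftrightarrow> j = Suc i \<or> i = Suc j"
proof -
  have lattice: "axis_path b i \<in> lattice_points n" for i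
    using assms by (rule axis_path_in_lattice_points)
  have "axis_path b i \<rightarrow>\<^bsub>lattice_graph n\<^esub> axis_path b j \<longleftrightarrow>
      euclid_dist n (axis_path b i) (axis_path b j) = 1"
    using lattice by (simp add: lattice_graph_def)
  also have "\<dots> \<longleftrightarrow> int j - int i \<in> {1, -1}"
    unfolding euclid_dist_eq_1_iff using n by (auto simp: axis_path_def)
  also have "\<dots> \<longleftrightarrow> j = Suc i \<or> i = Suc j"
    by auto
  finally show ?thesis .
qed

lemma inj_axis_path: "inj (axis_path b)"
  by (rule injI) (metis add_left_cancel axis_path_def fun_upd_same of_nat_eq_iff)

lemma digraph_iso_axis_path:
  assumes "b \<in> lattice_points n" and "0 < n"
  shows "digraph_iso (path_graph k) (lattice_graph n \<restriction> axis_path b ` {..<k})"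
proof -
  interpret graph "path_graph k" by (rule graph_path_graph)
  have verts: "verts (path_graph k) = {..<k}"
    by (simp add: path_graph_def)
  have "digraph_iso (path_graph k) (lattice_graph n \<restriction> axis_path b ` verts (path_graph k))"
  proof (rule digraph_iso_induce_image)
    show "inj_on (axis_path b) (verts (path_graph k))"
      using inj_axis_path by (rule inj_on_subset) simp
    show "axis_path b i \<rightarrow>\<^bsub>lattice_graph n\<^esub> axis_path b j \<longleftrightarrow> i \<rightarrow>\<^bsub>path_graph k\<^esub> j"
      if "i \<in> verts (path_graph k)" "j \<in> verts (path_graph k)" for i j
      using that by (simp add: axis_path_adj_iff[OF assms] path_graph_def)
  qed (rule wf_digraph_axioms, simp_all add: path_graph_def lattice_graph_def)
  then show ?thesis
    by (simp only: verts)
qed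

section \<open>Colouring the lattice by residues\<close>

lemma mod_diff_less_iff:
  fixes q a c m :: int
  assumes "0 \<le> q" "q < m" "0 \<le> a" "a + c \<le> m" "0 \<le> c"
  shows "(q - a) mod m < c \<longleftrightarrow> a \<le> q \<and> q < a + c"
proof (cases "a \<le> q")
  case False
  then have "(q - a) mod m = q - a + m"
    using assms mod_pos_pos_trivial[of "q - a + m" m] by simp
  with False assms show ?thesis by simp
qed (use assms in auto)

lemma mod_reflect_less_iff:
  fixes z c m :: int
  assumes "0 \<le> c" "c \<le> m" "0 < m"
  shows "(c - 1 - z) mod m < c \<longleftrightarrow> z mod m < c"
proof -
  define q where "q = z mod m"
  have q: "0 \<le> q" "q < m" using assms by (simp_all add: q_def)
  have "(c - 1 - z) mod m = (c - 1 - q) mod m"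
    by (simp add: q_def mod_simps)
  also have "\<dots> < c \<longleftrightarrow> q < c"
  proof (cases "q < c")
    case False
    then have "(c - 1 - q) mod m = c - 1 - q + m"
      using q assms mod_pos_pos_trivial[of "c - 1 - q + m" m] by simp
    with False q show ?thesis by simp
  qed (use q assms in simp)
  finally show ?thesis by (simp add: q_def)
qed

lemma int_div_less_iff_less_mult:
  fixes x q c :: int
  assumes "0 < c"
  shows "x div c < q \<longleftrightarrow> x < q * c"
proof -
  have "x div c < q \<longleftrightarrow> real_of_int x / real_of_int c < real_of_int q"
    by (simp add: floor_less_iff flip: floor_divide_of_int_eq[where ?'a = real])
  also have "\<dots> \<longleftrightarrow> real_of_int x < real_of_int (q * c)"
    using assms by (simp add: pos_divide_less_eq)
  finally show ?thesis by linarith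
qed

lemma int_div_eq_iff_mult_bounds:
  fixes x q c :: int
  assumes "0 < c"
  shows "x div c = q \<longleftrightarrow> q * c \<le> x \<and> x < q * c + c"
  using int_div_less_iff_less_mult[OF assms, of x q]
    int_div_less_iff_less_mult[OF assms, of x "q + 1"]
  by (auto simp: distrib_right)

lemma sum_mult_fun_upd_add:
  fixes a x :: "'a \<Rightarrow> 'b::comm_semiring_0"
  assumes "finite A" "i \<in> A"
  shows "(\<Sum>j\<in>A. a j * (x(i := x i + s)) j) = (\<Sum>j\<in>A. a j * x j) + s * a i"
proof -
  have "(\<Sum>j\<in>A - {i}. a j * (x(i := x i + s)) j) = (\<Sum>j\<in>A - {i}. a j * x j)"
    by (rule sum.cong) auto
  then show ?thesis
    by (simp add: sum.remove[OF assms] algebra_simps)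
qed

locale path_colouring =
  fixes n k :: nat
  assumes n_pos: "0 < n" and k_pos: "0 < k"
begin

definition modulus :: int where
  "modulus = (2 * int n - 1) * int k + 2"

definition axis_weight :: "nat \<Rightarrow> int" where
  "axis_weight i = int i * int k + 1"

lemma modulus_gt: "int k + 1 < modulus"
proof -
  have "1 * int k \<le> (2 * int n - 1) * int k"
    using n_pos by (intro mult_right_mono) auto
  then show ?thesis by (simp add: modulus_def)
qed

lemma axis_weight_le:
  assumes "i < n"
  shows "axis_weight i + int k \<le> modulus"
proof -
  have "(int i + 1) * int k \<le> (2 * int n - 1) * int k"
    using assms by (intro mult_right_mono) auto
  then show ?thesis by (simp add: modulus_def axis_weight_def algebra_simps)
qed

text \<open>
  The reflection \<open>r \<mapsto> k - 1 - r\<close> maps \<open>[0, k)\<close> to itself and turns upward steps into downward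
  ones, so that both directions reduce to subtracting an axis weight.
\<close>

definition mirror :: "int \<Rightarrow> int \<Rightarrow> int" where
  "mirror s r = (if s = 1 then int k - 1 - r else r) mod modulus"

lemma mirror_bounds: "0 \<le> mirror s r" "mirror s r < modulus"
  using modulus_gt by (simp_all add: mirror_def)

lemma step_mod_less_iff:
  assumes i: "i < n" and s: "s \<in> {1, -1}"
  shows "(r + s * axis_weight i) mod modulus < int k \<longleftrightarrow> (mirror s r - 1) div int k = int i"
proof -
  have "(r + s * axis_weight i) mod modulus < int k \<longleftrightarrow>
      (mirror s r - axis_weight i) mod modulus < int k"
    using s mod_reflect_less_iff[of "int k" modulus "r + axis_weight i"] modulus_gt
    by (auto simp: mirror_def mod_simps algebra_simps)
  also have "\<dots> \<longleftrightarrow> axis_weight i \<le> mirror s r \<and> mirror s r < axis_weight i + int k"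
    using axis_weight_le[OF i] mirror_bounds
    by (intro mod_diff_less_iff) (simp_all add: axis_weight_def)
  also have "\<dots> \<longleftrightarrow> (mirror s r - 1) div int k = int i"
    using k_pos by (auto simp: int_div_eq_iff_mult_bounds axis_weight_def)
  finally show ?thesis .
qed

lemma step_within_eq_0:
  assumes "i < n" "s \<in> {1, -1}" "0 \<le> r" "r < int k"
    and "(r + s * axis_weight i) mod modulus < int k"
  shows "i = 0"
proof -
  have "mirror s r < int k"
    using assms(3,4) modulus_gt by (simp add: mirror_def)
  then have "(mirror s r - 1) div int k \<le> 0"
    using k_pos zdiv_mono1[of "mirror s r - 1" "int k - 1" "int k"] by simp
  then show ?thesis
    using assms(5) step_mod_less_iff[OF assms(1,2)] by simp
qed

lemma
  assumes r: "int k \<le> r" "r < modulus"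
  shows mirror_outside_ge: "s \<in> {1, -1} \<Longrightarrow> int k \<le> mirror s r"
    and mirror_outside_add: "mirror 1 r + mirror (-1) r = 2 * (int n * int k) + 1"
proof -
  have neg: "mirror (-1) r = r"
    using r k_pos by (simp add: mirror_def)
  have "(int k - 1 - r + modulus) mod modulus = int k - 1 - r + modulus"
    using r k_pos by (intro mod_pos_pos_trivial) auto
  then have pos: "mirror 1 r = int k - 1 - r + modulus"
    by (simp add: mirror_def)
  show "s \<in> {1, -1} \<Longrightarrow> int k \<le> mirror s r"
    using r neg pos by auto
  show "mirror 1 r + mirror (-1) r = 2 * (int n * int k) + 1"
    unfolding neg pos by (simp add: modulus_def algebra_simps)
qed

text \<open>
  The intervals \<open>[i k + 1, i k + k]\<close> with \<open>i < n\<close> tile \<open>[1, n k]\<close>, and \<open>r\<close> and its mirror image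
  sum to the odd number \<open>2 n k + 1\<close>, so exactly one of the two lies in \<open>[1, n k]\<close>.
\<close>

lemma ex1_step_from_outside:
  assumes r: "int k \<le> r" "r < modulus"
  shows "\<exists>!(i, s). i < n \<and> s \<in> {1, -1} \<and> (r + s * axis_weight i) mod modulus < int k"
proof -
  have quot_less_iff: "(mirror s r - 1) div int k < int n \<longleftrightarrow> mirror s r \<le> int n * int k" for s
    using k_pos by (auto simp: int_div_less_iff_less_mult)
  have mirror_le_iff: "mirror (-1) r \<le> int n * int k \<longleftrightarrow> \<not> mirror 1 r \<le> int n * int k"
    using mirror_outside_add[OF r] by linarith
  define s :: int where "s = (if mirror 1 r \<le> int n * int k then 1 else -1)"
  have s: "s \<in> {1, -1}" "mirror s r \<le> int n * int k"
    using mirror_le_iff by (simp_all add: s_def)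
  have uniq: "t = s" if "t \<in> {1, -1}" "mirror t r \<le> int n * int k" for t
    using that mirror_le_iff by (auto simp: s_def)
  define i where "i = nat ((mirror s r - 1) div int k)"
  have "1 \<le> mirror s r"
    using mirror_outside_ge[OF r s(1)] k_pos by linarith
  then have i: "(mirror s r - 1) div int k = int i"
    using k_pos by (simp add: i_def pos_imp_zdiv_nonneg_iff)
  show ?thesis
  proof (rule ex1I[of _ "(i, s)"])
    have "i < n"
      using quot_less_iff[of s] s(2) by (simp add: i)
    with s i show "case (i, s) of (i, s) \<Rightarrow>
        i < n \<and> s \<in> {1, -1} \<and> (r + s * axis_weight i) mod modulus < int k"
      by (simp add: step_mod_less_iff)
  next
    fix jt assume "case jt of (j, t) \<Rightarrow>
        j < n \<and> t \<in> {1, -1} \<and> (r + t * axis_weight j) mod modulus < int k"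
    then obtain j t where jt: "jt = (j, t)" "j < n" "t \<in> {1, -1}"
      and "(r + t * axis_weight j) mod modulus < int k"
      by (cases jt) auto
    then have quot: "(mirror t r - 1) div int k = int j"
      using step_mod_less_iff by simp
    with jt have "t = s"
      using quot_less_iff[of t] uniq[of t] by simp
    with quot i jt show "jt = (i, s)" by simp
  qed
qed

definition colour :: "(nat \<Rightarrow> int) \<Rightarrow> int" where
  "colour x = (\<Sum>i<n. axis_weight i * x i) mod modulus"

definition path_family :: "(nat \<Rightarrow> int) set" where
  "path_family = {x \<in> lattice_points n. colour x < int k}"

lemma colour_bounds: "0 \<le> colour x" "colour x < modulus"
  using modulus_gt by (simp_all add: colour_def)

lemma colour_fun_upd_add:
  "i < n \<Longrightarrow> colour (x(i := x i + s)) = (colour x + s * axis_weight i) mod modulus"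
  unfolding colour_def by (subst sum_mult_fun_upd_add) (simp_all add: mod_simps)

lemma colour_axis_path:
  assumes "colour b = 0" and "j < k"
  shows "colour (axis_path b j) = int j"
  using assms n_pos modulus_gt by (simp add: axis_path_def colour_fun_upd_add axis_weight_def)

lemma axis_path_in_path_family:
  assumes "b \<in> lattice_points n" "colour b = 0" "j < k"
  shows "axis_path b j \<in> path_family"
  using assms n_pos by (simp add: path_family_def axis_path_in_lattice_points colour_axis_path)

lemma path_familyE:
  assumes "x \<in> path_family"
  obtains b j where "b \<in> lattice_points n" "colour b = 0" "j < k" "x = axis_path b j"
proof
  let ?b = "x(0 := x 0 + - colour x)"
  show "?b \<in> lattice_points n"
    using assms n_pos by (simp add: path_family_def fun_upd_in_lattice_points)
  show "colour ?b = 0"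
    unfolding colour_fun_upd_add[OF n_pos] by (simp add: axis_weight_def)
  show "nat (colour x) < k" "x = axis_path ?b (nat (colour x))"
    using assms colour_bounds(1)[of x] by (auto simp: path_family_def axis_path_def)
qed

lemma axis_path_closed_adj:
  assumes b: "b \<in> lattice_points n" "colour b = 0" and j: "j < k"
    and y: "y \<in> path_family" "axis_path b j \<rightarrow>\<^bsub>lattice_graph n\<^esub> y"
  shows "y \<in> axis_path b ` {..<k}"
proof -
  let ?x = "axis_path b j"
  have "?x \<in> lattice_points n"
    using b(1) n_pos by (rule axis_path_in_lattice_points)
  then obtain i s where i: "i < n" and s: "s \<in> {1, -1}" and y_eq: "y = ?x(i := ?x i + s)"
    using y(2) unfolding lattice_graph_adj_iff[OF \<open>?x \<in> lattice_points n\<close>] by blast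
  have colour_y: "(int j + s * axis_weight i) mod modulus < int k"
    using y(1) b(2) i j by (simp add: y_eq path_family_def colour_fun_upd_add colour_axis_path)
  with i s j have "i = 0"
    by (intro step_within_eq_0[of i s "int j"]) auto
  with colour_y have step: "(int j + s) mod modulus < int k"
    by (simp add: axis_weight_def)
  have nonneg: "0 \<le> int j + s"
  proof (rule ccontr)
    assume "\<not> ?thesis"
    then have "int j + s = -1" using s by auto
    then show False
      using step modulus_gt by (simp add: zmod_minus1)
  qed
  moreover have "int j + s < modulus"
    using s j modulus_gt by auto
  ultimately have less: "int j + s < int k"
    using step by simp
  have "y = axis_path b (nat (int j + s))"
    using nonneg by (simp add: y_eq \<open>i = 0\<close> axis_path_def add.assoc)
  with nonneg less show ?thesis
    by (simp add: nat_less_iff)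
qed

interpretation family: sym_digraph "lattice_graph n \<restriction> path_family"
proof -
  interpret sym_digraph "lattice_graph n" by (rule sym_digraph_lattice_graph)
  show "sym_digraph (lattice_graph n \<restriction> path_family)"
    by (intro induced_graph_imp_graph induced_induce)
      (auto simp: path_family_def lattice_graph_def)
qed

lemma reachable_axis_path:
  assumes b: "b \<in> lattice_points n" "colour b = 0" and j: "j < k"
  shows "axis_path b 0 \<rightarrow>\<^sup>*\<^bsub>lattice_graph n \<restriction> path_family\<^esub> axis_path b j"
  using j
proof (induction j)
  case 0
  then show ?case
    using axis_path_in_path_family[OF b] by simp
next
  case (Suc j)
  then have "axis_path b 0 \<rightarrow>\<^sup>*\<^bsub>lattice_graph n \<restriction> path_family\<^esub> axis_path b j"
    by simp
  also have "axis_path b j \<rightarrow>\<^bsub>lattice_graph n \<restriction> path_family\<^esub> axis_path b (Suc j)"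
    using Suc.prems b n_pos
    by (simp add: adj_induce_subgraph_iff axis_path_adj_iff axis_path_in_path_family)
  finally (family.reachable_adj_trans) show ?case .
qed

lemma scc_of_axis_path:
  assumes b: "b \<in> lattice_points n" "colour b = 0" and j: "j < k"
  shows "family.scc_of (axis_path b j) = axis_path b ` {..<k}"
proof -
  have "y \<in> axis_path b ` {..<k}"
    if "axis_path b j \<rightarrow>\<^sup>*\<^bsub>lattice_graph n \<restriction> path_family\<^esub> y" for y
    using that
  proof (induction rule: family.reachable_induct)
    case base
    then show ?case using j by simp
  next
    case (step y z)
    then show ?case
      using axis_path_closed_adj[OF b] by (auto simp: adj_induce_subgraph_iff)
  qed
  moreover have "axis_path b i \<in> family.scc_of (axis_path b j)" if "i < k" for i
    using family.scc_ofI_reachable[OF reachable_axis_path[OF b j]]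
      family.scc_ofI_reachable'[OF reachable_axis_path[OF b that]] family.scc_of_eq
    by metis
  ultimately show ?thesis
    by (auto simp: family.scc_of_def)
qed

lemma digraph_iso_component_path_family:
  assumes "C \<in> components (lattice_graph n \<restriction> path_family)"
  shows "digraph_iso C (path_graph k)"
proof -
  interpret path: graph "path_graph k" by (rule graph_path_graph)
  obtain v where v: "v \<in> path_family"
    and C: "C = (lattice_graph n \<restriction> path_family) \<restriction> family.scc_of v"
    using assms by (auto simp: family.components_eq_induce_scc_of)
  obtain b j where b: "b \<in> lattice_points n" "colour b = 0" and "j < k" "v = axis_path b j"
    using v by (rule path_familyE)
  then have "C = (lattice_graph n \<restriction> path_family) \<restriction> axis_path b ` {..<k}"
    by (simp add: C scc_of_axis_path)
  also have "\<dots> = lattice_graph n \<restriction> axis_path b ` {..<k}"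
    by (rule induce_subgraph_induce_subgraph) (auto intro: axis_path_in_path_family[OF b])
  finally have "digraph_iso (path_graph k) C"
    using digraph_iso_axis_path[OF b(1) n_pos] by simp
  with path.wf_digraph_axioms show ?thesis
    by (rule digraph_iso_swap)
qed

lemma ex1_adj_path_family:
  assumes v: "v \<in> lattice_points n" "v \<notin> path_family"
  shows "\<exists>!w. w \<in> path_family \<and> v \<rightarrow>\<^bsub>lattice_graph n\<^esub> w"
proof -
  define into where "into i s \<longleftrightarrow> i < n \<and> s \<in> {1, -1} \<and>
    (colour v + s * axis_weight i) mod modulus < int k" for i s
  have "int k \<le> colour v"
    using v by (simp add: path_family_def)
  then have ex1: "\<exists>!(i, s). into i s"
    unfolding into_def using colour_bounds(2) by (rule ex1_step_from_outside)
  then obtain i s where into: "into i s" by auto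
  have uniq: "j = i \<and> t = s" if "into j t" for j t
    using ex1 into that by (auto simp: Ex1_def)
  have "v(j := v j + t) \<in> path_family \<longleftrightarrow> (colour v + t * axis_weight j) mod modulus < int k"
    if "j < n" for j t
    using v(1) that by (simp add: path_family_def fun_upd_in_lattice_points colour_fun_upd_add)
  then have "w \<in> path_family \<and> v \<rightarrow>\<^bsub>lattice_graph n\<^esub> w \<longleftrightarrow>
      (\<exists>j t. into j t \<and> w = v(j := v j + t))" for w
    unfolding lattice_graph_adj_iff[OF v(1)] into_def by blast
  with into uniq show ?thesis
    by (intro ex1I[of _ "v(i := v i + s)"]) blast+
qed

lemma PDDS_of_path_family: "PDDS_of (lattice_graph n) 1 (path_graph k) path_family"
proof -
  interpret sym_digraph "lattice_graph n" by (rule sym_digraph_lattice_graph)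
  have verts: "verts (lattice_graph n) = lattice_points n"
    by (simp add: lattice_graph_def)
  have "PDDS (lattice_graph n) 1 path_family"
  proof (rule PDDS_1_if_ex1_adj)
    show "path_family \<subseteq> verts (lattice_graph n)"
      by (auto simp: path_family_def verts)
    show "\<exists>!w. w \<in> path_family \<and> v \<rightarrow>\<^bsub>lattice_graph n\<^esub> w"
      if "v \<in> verts (lattice_graph n)" "v \<notin> path_family" for v
      using that unfolding verts by (rule ex1_adj_path_family)
  qed
  then show ?thesis
    by (simp add: PDDS_of_def digraph_iso_component_path_family)
qed

end

theorem theorem7:
  fixes n k :: nat
  assumes "n \<ge> 2" and "k \<ge> 1"
  shows "\<exists>S. PDDS_of (lattice_graph n) 1 (path_graph k) S"
proof -
  interpret path_colouring n k
    using assms by unfold_locales simp_all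
  show ?thesis
    using PDDS_of_path_family by blast
qed

end
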